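(* Let $X$ be an infinite-dimensional Polish topological vector space and let $T\in\mathfrak L(X)$. If $T$ satisfies the Frequent Hypercyclicity Criterion, then $T$ is hereditarily frequently hypercyclic.
   Context: $\mathfrak L(X)$ denotes the space of continuous linear operators on $X$. For $x\in X$ and $V\subset X$, $\mathcal N_T(x,V):=\{n\in\mathbb N: T^nx\in V\}$. The lower density of $A\subset\mathbb N$ is $\liminf_{N\to\infty}\frac{\#(A\cap[1,N])}{N}$. An operator $T$ satisfies the Frequent Hypercyclicity Criterion if there exist a dense set $\mathcal D\subset X$ and a map $S:\mathcal D\to\mathcal D$ such that $TSx=x$ for all $x\in\mathcal D$, and for every $x\in\mathcal D$ the series $\sum_n T^nx$ and $\sum_n S^nx$ are unconditionally convergent. $T$ is hereditarily frequently hypercyclic if for every countable family $(V_i)_{i\in I}$ of non-empty open subsets of $X$ and every family $(A_i)_{i\in I}$ of subsets of $\mathbb N$ with positive lower density (indexed by the same countable set $I$), there exists $x\in X$ such that $\mathcal N_T(x,V_i)\cap A_i$ has positive lower density for every $i\in I$. *)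

theory Defs
  imports "HOL-Analysis.Analysis"
begin

definition polish_tvs :: "'a::{real_vector, topological_space} itself \<Rightarrow> bool" where
  "polish_tvs _ \<longleftrightarrow>
     continuous_on UNIV (\<lambda>p::'a \<times> 'a. fst p + snd p) \<and>
     continuous_on UNIV (\<lambda>p::real \<times> 'a. fst p *\<^sub>R snd p) \<and>
     separable_space (euclidean :: 'a topology) \<and>
     completely_metrizable_space (euclidean :: 'a topology)"

definition infinite_dimensional :: "'a::real_vector itself \<Rightarrow> bool" where
  "infinite_dimensional _ \<longleftrightarrow> \<not> (\<exists>B::'a set. finite B \<and> span B = UNIV)"

definition cont_linear_op :: "('a::{real_vector, topological_space} \<Rightarrow> 'a) \<Rightarrow> bool" where
  "cont_linear_op T \<longleftrightarrow> linear T \<and> continuous_on UNIV T"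

definition uncond_convergent :: "(nat \<Rightarrow> 'a::{topological_space, comm_monoid_add}) \<Rightarrow> bool" where
  "uncond_convergent x \<longleftrightarrow> (\<forall>\<sigma>::nat \<Rightarrow> nat. bij \<sigma> \<longrightarrow> (\<exists>s. (\<lambda>n. x (\<sigma> n)) sums s))"

definition return_set :: "('a \<Rightarrow> 'a) \<Rightarrow> 'a \<Rightarrow> 'a set \<Rightarrow> nat set" where
  "return_set T x V = {n. (T ^^ n) x \<in> V}"

definition lower_density :: "nat set \<Rightarrow> ereal" where
  "lower_density A = liminf (\<lambda>N. ereal (real (card (A \<inter> {1..N})) / real N))"

definition freq_hc_criterion :: "('a::{real_vector, topological_space} \<Rightarrow> 'a) \<Rightarrow> bool" where
  "freq_hc_criterion T \<longleftrightarrow>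
     (\<exists>D S. closure D = UNIV \<and> S ` D \<subseteq> D \<and> (\<forall>x\<in>D. T (S x) = x) \<and>
        (\<forall>x\<in>D. uncond_convergent (\<lambda>n. (T ^^ n) x) \<and> uncond_convergent (\<lambda>n. (S ^^ n) x)))"

text \<open>Countable index families are represented by index sets I \<subseteq> nat.\<close>
definition hered_freq_hypercyclic :: "('a::{real_vector, topological_space} \<Rightarrow> 'a) \<Rightarrow> bool" where
  "hered_freq_hypercyclic T \<longleftrightarrow>
     (\<forall>(I::nat set) (V::nat \<Rightarrow> 'a set) (A::nat \<Rightarrow> nat set).
        (\<forall>i\<in>I. open (V i) \<and> V i \<noteq> {} \<and> lower_density (A i) > 0) \<longrightarrow>
        (\<exists>x. \<forall>i\<in>I. lower_density (return_set T x (V i) \<inter> A i) > 0))"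

end

theory Submission
  imports Defs
begin

text \<open>Pick \<open>x j \<in> D \<inter> V j\<close> and thin the sets \<open>A j\<close> to sets \<open>E j\<close> of positive lower density whose elements
  are so far apart, from each other and from those of every other \<open>E i\<close>, that the vector
  \<open>l = (\<Sum>j. \<Sum>n\<in>E j. S\<^sup>n (x j))\<close> exists and, for \<open>m \<in> E i\<close>, all terms of
  \<open>T\<^sup>m l = x i + (\<Sum>n<m. T\<^sup>m\<^sup>-\<^sup>n (x j)) + (\<Sum>n>m. S\<^sup>n\<^sup>-\<^sup>m (x j))\<close> other than \<open>x i\<close> add up to a vector so small
  that \<open>T\<^sup>m l \<in> V i\<close>. The topology is handled through a sequence of neighbourhoods \<open>W k\<close> of zero with
  \<open>W (k + 1) + W (k + 1) \<subseteq> W k\<close>.\<close>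

subsection \<open>Separated sets of positive lower density\<close>

text \<open>The liminf is traded for a linear lower bound on the counting function, so that density
  estimates become estimates of cardinalities. The slope is any real number strictly between 0 and
  the density.\<close>

lemma lower_density_pos_iff:
  "lower_density A > 0 \<longleftrightarrow>
     (\<exists>c>0. \<forall>\<^sub>F n in sequentially. c * real n \<le> real (card (A \<inter> {1..n})))"
proof
  assume "lower_density A > 0"
  then obtain c where c: "0 < ereal c" "ereal c < lower_density A"
    using ereal_dense2 by blast
  then have y: "\<forall>\<^sub>F n in sequentially. ereal c < ereal (real (card (A \<inter> {1..n})) / real n)"
    unfolding lower_density_def by (intro less_LiminfD)
  have "\<forall>\<^sub>F n in sequentially. c * real n \<le> real (card (A \<inter> {1..n}))"
    using y eventually_gt_at_top[of 0] by eventually_elim (simp add: field_simps)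
  then show "\<exists>c>0. \<forall>\<^sub>F n in sequentially. c * real n \<le> real (card (A \<inter> {1..n}))"
    using c(1) by auto
next
  assume "\<exists>c>0. \<forall>\<^sub>F n in sequentially. c * real n \<le> real (card (A \<inter> {1..n}))"
  then obtain c where c: "c > 0" "\<forall>\<^sub>F n in sequentially. c * real n \<le> real (card (A \<inter> {1..n}))"
    by blast
  have "\<forall>\<^sub>F n in sequentially. ereal c \<le> ereal (real (card (A \<inter> {1..n})) / real n)"
    using c(2) eventually_gt_at_top[of 0] by eventually_elim (simp add: field_simps)
  then have "ereal c \<le> lower_density A"
    unfolding lower_density_def by (rule Liminf_bounded)
  then show "lower_density A > 0"
    using c(1) by (metis ereal_less(2) order_less_le_trans)
qed

lemma lower_density_mono:
  assumes "A \<subseteq> B"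
  shows "lower_density A \<le> lower_density B"
  unfolding lower_density_def
proof (rule Liminf_mono, intro always_eventually allI)
  fix n
  have "card (A \<inter> {1..n}) \<le> card (B \<inter> {1..n})"
    by (rule card_mono) (use assms in auto)
  then show "ereal (real (card (A \<inter> {1..n})) / real n) \<le> ereal (real (card (B \<inter> {1..n})) / real n)"
    by (simp add: divide_right_mono)
qed

text \<open>If a1 < a2 < ... are the positive elements of \<open>A\<close>, this is {aK, a2K, ...}.
  Divisibility of the counting function replaces an explicit enumeration, which would have to treat
  finite \<open>A\<close> separately.\<close>

definition every_nth :: "nat \<Rightarrow> nat set \<Rightarrow> nat set" where
  "every_nth K A = {n \<in> A. 0 < n \<and> K dvd card (A \<inter> {1..n})}"

section \<open>Counting functions and thinned sets\<close>

lemma card_Int_Suc: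
  "card (A \<inter> {1..Suc n}) = card (A \<inter> {1..n}) + of_bool (Suc n \<in> A)"
proof (cases "Suc n \<in> A")
  case True
  then have "A \<inter> {1..Suc n} = insert (Suc n) (A \<inter> {1..n})"
    by (auto simp: le_Suc_eq)
  then show ?thesis using True by simp
next
  case False
  then have "A \<inter> {1..Suc n} = A \<inter> {1..n}"
    by (auto simp: le_Suc_eq)
  then show ?thesis using False by simp
qed

lemma card_Int_le_add:
  assumes "m \<le> n"
  shows "card (A \<inter> {1..n}) \<le> card (A \<inter> {1..m}) + (n - m)"
  using assms
proof (induction n rule: dec_induct)
  case (step n)
  then show ?case by (simp add: card_Int_Suc Suc_diff_le del: One_nat_def)
qed simp

text \<open>An element is kept exactly when the counting function of \<open>A\<close> steps up to a
  multiple of \<open>K\<close>, which is when the quotient on the right jumps.\<close>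

lemma card_every_nth:
  assumes "K > 0"
  shows "card (every_nth K A \<inter> {1..n}) = card (A \<inter> {1..n}) div K"
proof (induction n)
  case (Suc n)
  have "Suc n \<in> every_nth K A \<longleftrightarrow> Suc n \<in> A \<and> K dvd Suc (card (A \<inter> {1..n}))"
    unfolding every_nth_def using card_Int_Suc[of A n] by auto
  then show ?case
    using assms unfolding card_Int_Suc Suc by (auto simp: div_Suc dvd_eq_mod_eq_0)
qed simp

text \<open>The counting function of \<open>A\<close> takes distinct multiples of \<open>K\<close>
  at the two elements, and it grows by at most one per step.\<close>

lemma every_nth_gap:
  assumes "m \<in> every_nth K A" "n \<in> every_nth K A" "m < n"
  shows "K \<le> n - m"
proof -
  let ?c = "\<lambda>n. card (A \<inter> {1..n})"
  have "?c m < ?c n"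
  proof (rule psubset_card_mono)
    have "n \<in> A \<inter> {1..n}" "n \<notin> A \<inter> {1..m}"
      using assms by (auto simp: every_nth_def)
    moreover have "A \<inter> {1..m} \<subseteq> A \<inter> {1..n}"
      using assms(3) by auto
    ultimately show "A \<inter> {1..m} \<subset> A \<inter> {1..n}"
      by blast
  qed simp
  moreover have "K dvd ?c n - ?c m"
    using assms by (auto simp: every_nth_def)
  ultimately have "K \<le> ?c n - ?c m"
    by (intro dvd_imp_le) auto
  then show ?thesis
    using card_Int_le_add[of m n A] assms(3) by linarith
qed

text \<open>The counting function of \<open>A\<close> at \<open>n\<close> is a positive multiple of
  \<open>K\<close>, and it never exceeds \<open>n\<close>.\<close>

lemma every_nth_ge:
  assumes "n \<in> every_nth K A"
  shows "K \<le> n"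
proof -
  have "n \<in> A \<inter> {1..n}"
    using assms by (auto simp: every_nth_def)
  then have "card (A \<inter> {1..n}) > 0"
    by (metis card_gt_0_iff empty_iff finite_Int finite_atLeastAtMost)
  then have "K \<le> card (A \<inter> {1..n})"
    using assms by (auto simp: every_nth_def intro: dvd_imp_le)
  also have "\<dots> \<le> n"
    using card_mono[of "{1..n}" "A \<inter> {1..n}"] by simp
  finally show ?thesis .
qed

text \<open>The sets \<open>E0 j\<close> consist of every \<open>K j\<close>-th element of \<open>A j\<close>, with \<open>K j\<close> growing so fast that deleting
  from \<open>E0 i\<close> the \<open>N j\<close>-neighbourhoods of all later \<open>E0 j\<close> costs at most a quarter of its density. Up to
  \<open>n\<close> only the elements of \<open>E0 j\<close> below \<open>2 n\<close> matter, since all of them exceed \<open>2 N j\<close>.\<close>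
lemma separated_subsets:
  fixes A :: "nat \<Rightarrow> nat set" and N :: "nat \<Rightarrow> nat"
  assumes dens: "\<And>i. lower_density (A i) > 0" and N: "mono N"
  obtains E where "\<And>i. E i \<subseteq> A i" "\<And>i. lower_density (E i) > 0"
    "\<And>i n. n \<in> E i \<Longrightarrow> N i \<le> n"
    "\<And>i j n. n \<in> E i \<Longrightarrow> n \<in> E j \<Longrightarrow> i = j"
    "\<And>i j m n. m \<in> E i \<Longrightarrow> n \<in> E j \<Longrightarrow> m < n \<Longrightarrow> N (max i j) \<le> n - m"
proof -
  \<comment> \<open>The slope is capped at 1 so that \<open>C k \<le> M k * a k\<close> will give
    \<open>C k \<le> M k\<close>.\<close>
  have "\<exists>c. 0 < c \<and> c \<le> 1 \<and> (\<forall>\<^sub>F n in sequentially. c * real n \<le> real (card (A i \<inter> {1..n})))" for i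
  proof -
    obtain c where c: "c > 0" "\<forall>\<^sub>F n in sequentially. c * real n \<le> real (card (A i \<inter> {1..n}))"
      using dens lower_density_pos_iff by blast
    from c(2) have "\<forall>\<^sub>F n in sequentially. min c 1 * real n \<le> real (card (A i \<inter> {1..n}))"
    proof eventually_elim
      case (elim n)
      have "min c 1 * real n \<le> c * real n"
        by (intro mult_right_mono) auto
      then show ?case using elim by linarith
    qed
    then show ?thesis using c(1) by (intro exI[of _ "min c 1"]) auto
  qed
  then obtain a where a: "\<And>i. 0 < a i" "\<And>i. a i \<le> (1::real)"
    "\<And>i. \<forall>\<^sub>F n in sequentially. a i * real n \<le> real (card (A i \<inter> {1..n}))"
    by metis
  \<comment> \<open>The factor \<open>2 * N k + 1\<close> bounds the size of an
    \<open>N k\<close>-neighbourhood of a point, 2 comes from counting up to \<open>2 * n\<close>,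
    and \<open>2 ^ (k + 3)\<close> makes the losses a geometric series with sum at most a
    quarter.\<close>
  define C where "C k = real (2 * N k + 1) * 2 * 2 ^ (k + 3)" for k
  have "\<exists>M::nat. \<forall>i\<le>k. C k \<le> real M * a i" for k
  proof -
    obtain M :: nat where M: "(\<Sum>i\<le>k. C k / a i) \<le> real M"
      using real_arch_simple by blast
    have "C k \<le> real M * a i" if "i \<le> k" for i
    proof -
      have "C k / a i \<le> (\<Sum>i\<le>k. C k / a i)"
        by (rule member_le_sum) (use that a(1) in \<open>auto simp: C_def less_imp_le\<close>)
      then have "C k / a i \<le> real M" using M by linarith
      then show ?thesis using a(1)[of i] by (simp add: divide_simps)
    qed
    then show ?thesis by blast
  qed
  then obtain M :: "nat \<Rightarrow> nat" where M: "\<And>k i. i \<le> k \<Longrightarrow> C k \<le> real (M k) * a i"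
    by metis
  have M_ge: "C k \<le> real (M k)" for k
  proof -
    have "real (M k) * a k \<le> real (M k) * 1"
      by (intro mult_left_mono a) auto
    then show ?thesis using M[of k k] by simp
  qed
  \<comment> \<open>As a product, \<open>K j\<close> is at least \<open>K i * M j\<close> for every
    \<open>i < j\<close>. The loss caused by \<open>E0 j\<close> can thus be compared with the
    density \<open>a i / K i\<close> left in \<open>E0 i\<close>, for all earlier \<open>i\<close>
    at once.\<close>
  define K where "K j = (\<Prod>k\<le>j. M k)" for j
  have M_large: "2 * N k + 2 ^ k < M k" for k
  proof -
    have "real (2 * N k + 2 ^ k) < C k"
    proof -
      have "real (2 * N k) \<le> real (2 * N k) * 2 * 2 ^ (k+3)"
      proof -
        have "(1::real) \<le> 2 * 2 ^ (k+3)"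
          using one_le_power[of "2::real" "k + 4"] by (simp add: power_add)
        then show ?thesis
          using mult_left_mono[of 1 "2 * 2 ^ (k+3)" "real (2 * N k)"]
          by (simp only: mult.assoc mult_1_right of_nat_0_le_iff)
      qed
      moreover have "(2::real) ^ k < 2 * 2 ^ (k+3)"
        by (simp add: power_add)
      ultimately show ?thesis unfolding C_def by (simp add: algebra_simps)
    qed
    then show ?thesis using M_ge[of k] by linarith
  qed
  have M_pos: "M k > 0" for k using M_large[of k] by linarith
  have K_pos: "K j > 0" for j unfolding K_def using M_pos by (simp add: prod_pos)
  have K_ge: "K i * M j \<le> K j" if ij: "i < j" for i j
  proof -
    obtain j' where j': "j = Suc j'" "i \<le> j'" using ij by (cases j) auto
    have "K i dvd K j'"
      unfolding K_def by (rule prod_dvd_prod_subset) (use j' in auto)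
    then have "K i \<le> K j'" using K_pos by (auto intro: dvd_imp_le)
    then show ?thesis using j' by (simp add: K_def)
  qed
  have K_large: "2 * N j + 2 ^ j < K j" for j
  proof -
    have "M j dvd K j" unfolding K_def by (rule dvd_prodI) auto
    then have "M j \<le> K j" using K_pos by (auto intro: dvd_imp_le)
    then show ?thesis using M_large[of j] by linarith
  qed
  define E0 where "E0 j = every_nth (K j) (A j)" for j
  \<comment> \<open>Only later indices delete points. Since \<open>E j\<close> is contained in
    \<open>E0 j\<close>, this still separates \<open>E i\<close> from \<open>E j\<close> by more
    than \<open>N j\<close> when \<open>i < j\<close>; within one \<open>E i\<close> the gap
    \<open>K i\<close> does it.\<close>
  define E where "E i = {n \<in> E0 i. \<forall>j>i. \<forall>m\<in>E0 j. n + N j < m \<or> m + N j < n}" for i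
  have sub: "E i \<subseteq> A i" for i
    unfolding E_def E0_def every_nth_def by auto
  have ge: "K i \<le> n" if "n \<in> E0 i" for i n
    using that every_nth_ge unfolding E0_def by blast
  have disj: False if "n \<in> E i" "n \<in> E j" "i < j" for i j n
    using that unfolding E_def by auto
  have sep: "N (max i j) \<le> n - m" if "m \<in> E i" "n \<in> E j" "m < n" for i j m n
  proof (cases i j rule: linorder_cases)
    case equal
    then have "K i \<le> n - m"
      using that every_nth_gap unfolding E_def E0_def by blast
    then show ?thesis using equal K_large[of i] by simp
  qed (use that in \<open>force simp: E_def max_def\<close>)+
  have dens_E: "lower_density (E i) > 0" for i
  proof -
    define c where "c = a i / real (K i)"
    have c: "c > 0" using a(1) K_pos by (simp add: c_def)
    have key: "real (card (E0 i \<inter> {1..n})) \<le> real (card (E i \<inter> {1..n})) + c / 4 * real n" for n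
    proof -
      let ?B = "\<lambda>j. \<Union>m\<in>E0 j \<inter> {1..2*n}. {m - N j..m + N j}"
      have "E0 i \<inter> {1..n} \<subseteq> (E i \<inter> {1..n}) \<union> (\<Union>j\<in>{i<..2*n}. ?B j)"
      proof
        fix l assume l: "l \<in> E0 i \<inter> {1..n}"
        show "l \<in> (E i \<inter> {1..n}) \<union> (\<Union>j\<in>{i<..2*n}. ?B j)"
        proof (cases "l \<in> E i")
          case False
          then obtain j m where jm: "j > i" "m \<in> E0 j" "m \<le> l + N j" "l \<le> m + N j"
            using l unfolding E_def by force
          \<comment> \<open>Combined with \<open>m \<le> n + N j\<close>, this gives
            \<open>m < 2 * n\<close> and \<open>j < 2 ^ j < n\<close>: the term
            \<open>2 * N j\<close> bounds the deleting element and the term \<open>2 ^ j\<close>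
            bounds its index, so the union is finite.\<close>
          have "2 * N j + 2 ^ j < m" using ge[OF jm(2)] K_large[of j] by linarith
          moreover have "j < 2 ^ j" by simp
          moreover have "l \<le> n" using l by simp
          ultimately have "m \<le> 2 * n" "j \<le> 2 * n" "1 \<le> m"
            using jm(3) by linarith+
          then show ?thesis using jm by force
        qed (use l in auto)
      qed
      then have "card (E0 i \<inter> {1..n}) \<le> card ((E i \<inter> {1..n}) \<union> (\<Union>j\<in>{i<..2*n}. ?B j))"
        by (rule card_mono[rotated]) auto
      also have "\<dots> \<le> card (E i \<inter> {1..n}) + card (\<Union>j\<in>{i<..2*n}. ?B j)"
        by (rule card_Un_le)
      also have "card (\<Union>j\<in>{i<..2*n}. ?B j) \<le> (\<Sum>j\<in>{i<..2*n}. card (?B j))"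
        by (rule card_UN_le) auto
      also have "\<dots> \<le> (\<Sum>j\<in>{i<..2*n}. card (E0 j \<inter> {1..2*n}) * (2 * N j + 1))"
      proof (rule sum_mono)
        fix j
        have "card (?B j) \<le> (\<Sum>m\<in>E0 j \<inter> {1..2*n}. card {m - N j..m + N j})"
          by (rule card_UN_le) auto
        also have "\<dots> \<le> (\<Sum>m\<in>E0 j \<inter> {1..2*n}. 2 * N j + 1)"
          by (rule sum_mono) auto
        finally show "card (?B j) \<le> card (E0 j \<inter> {1..2*n}) * (2 * N j + 1)" by simp
      qed
      finally have "real (card (E0 i \<inter> {1..n}))
          \<le> real (card (E i \<inter> {1..n}) + (\<Sum>j\<in>{i<..2*n}. card (E0 j \<inter> {1..2*n}) * (2 * N j + 1)))"
        by (simp only: of_nat_le_iff)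
      also have "\<dots> = real (card (E i \<inter> {1..n}))
          + (\<Sum>j\<in>{i<..2*n}. real (card (E0 j \<inter> {1..2*n})) * real (2 * N j + 1))"
        by (simp only: of_nat_add of_nat_sum of_nat_mult)
      also have "(\<Sum>j\<in>{i<..2*n}. real (card (E0 j \<inter> {1..2*n})) * real (2 * N j + 1))
          \<le> (\<Sum>j\<in>{i<..2*n}. c * real n / 8 * (1/2) ^ j)"
      proof (rule sum_mono)
        fix j assume "j \<in> {i<..2*n}"
        then have ij: "i < j" by simp
        have "card (A j \<inter> {1..2*n}) \<le> 2 * n"
          using card_mono[of "{1..2*n}" "A j \<inter> {1..2*n}"] by simp
        then have "card (E0 j \<inter> {1..2*n}) \<le> (2 * n) div K j"
          unfolding E0_def card_every_nth[OF K_pos] by (rule div_le_mono)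
        then have "real (card (E0 j \<inter> {1..2*n})) \<le> real (2 * n) / real (K j)"
          using of_nat_div_le_of_nat[of "2*n" "K j"] by (meson of_nat_mono order_trans)
        then have "real (card (E0 j \<inter> {1..2*n})) * real (2 * N j + 1)
            \<le> real (2 * n) / real (K j) * real (2 * N j + 1)"
          by (rule mult_right_mono) simp
        also have "\<dots> = real n * (C j / 2 ^ (j + 3)) / real (K j)"
          by (simp add: C_def)
        also have "\<dots> \<le> real n * (C j / 2 ^ (j + 3)) / (real (K i) * real (M j))"
          using K_ge[OF ij] K_pos M_pos
          by (intro divide_left_mono) (auto simp: C_def simp flip: of_nat_mult)
        also have "\<dots> \<le> real n * (real (M j) * a i / 2 ^ (j + 3)) / (real (K i) * real (M j))"
          by (intro divide_right_mono mult_left_mono M) (use ij in auto)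
        also have "\<dots> = c * real n / 8 * (1/2) ^ j"
          using M_pos[of j] by (simp add: c_def power_add power_divide mult_ac)
        finally show "real (card (E0 j \<inter> {1..2*n})) * real (2 * N j + 1) \<le> c * real n / 8 * (1/2) ^ j" .
      qed
      also have "\<dots> = c * real n / 8 * (\<Sum>j\<in>{i<..2*n}. (1/2) ^ j)"
        by (simp add: sum_distrib_left)
      also have "\<dots> \<le> c * real n / 8 * 2"
      proof (rule mult_left_mono)
        have "(\<Sum>j\<in>{i<..2*n}. (1/2::real) ^ j) \<le> (\<Sum>j. (1/2) ^ j)"
          by (rule sum_le_suminf) (auto simp: summable_geometric)
        then show "(\<Sum>j\<in>{i<..2*n}. (1/2::real) ^ j) \<le> 2"
          by (simp add: suminf_geometric)
      qed (use c in auto)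
      finally show ?thesis by simp
    qed
    \<comment> \<open>Rounding in the integer division loses at most 1, which is another quarter of
      \<open>c * n\<close> for large \<open>n\<close>. With the quarter lost by deletion, slope
      \<open>c / 2\<close> remains.\<close>
    have "\<forall>\<^sub>F n in sequentially. 1 \<le> c / 4 * real n"
      using eventually_ge_at_top[of "nat \<lceil>4 / c\<rceil>"]
    proof eventually_elim
      case (elim n)
      then have "4 / c \<le> real n" by linarith
      then show ?case using c by (simp add: field_simps)
    qed
    with a(3)[of i] have "\<forall>\<^sub>F n in sequentially. c / 2 * real n \<le> real (card (E i \<inter> {1..n}))"
    proof eventually_elim
      case (elim n)
      let ?x = "card (A i \<inter> {1..n})"
      have "c * real n \<le> real ?x / real (K i)"
        using elim(1) K_pos[of i] by (simp add: c_def divide_right_mono)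
      also have "\<dots> \<le> real (?x div K i) + 1"
      proof -
        have "?x \<le> K i * (?x div K i) + K i"
          using dividend_less_times_div[OF K_pos, of ?x i] by linarith
        then have "real ?x \<le> real (K i * (?x div K i) + K i)"
          by (simp only: of_nat_le_iff)
        then have "real ?x \<le> (real (?x div K i) + 1) * real (K i)"
          by (simp only: of_nat_add of_nat_mult distrib_right mult_1 mult.commute[of "real (K i)"])
        then show ?thesis using K_pos[of i] by (simp only: pos_divide_le_eq of_nat_0_less_iff)
      qed
      also have "?x div K i = card (E0 i \<inter> {1..n})"
        unfolding E0_def using card_every_nth[OF K_pos] by simp
      finally have "c * real n \<le> real (card (E0 i \<inter> {1..n})) + 1" .
      then show ?case using key[of n] elim(2) by linarith
    qed
    then show ?thesis
      unfolding lower_density_pos_iff using c by (intro exI[of _ "c / 2"]) auto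
  qed
  show thesis
  proof (rule that[of E])
    fix i n assume "n \<in> E i"
    then show "N i \<le> n" using ge[of n i] K_large[of i] by (simp add: E_def)
  next
    fix i j n assume "n \<in> E i" "n \<in> E j"
    then show "i = j" using disj by (metis linorder_neqE_nat)
  qed (fact sub dens_E sep)+
qed

subsection \<open>Polish topological vector spaces\<close>

text \<open>The \<open>W k\<close> behave like balls of radius 2^-k around zero for a
  translation-invariant metric. The last assumption transports the base from zero to every other
  point.\<close>

locale zero_base =
  fixes W :: "nat \<Rightarrow> 'a::{real_vector, topological_space} set"
  assumes open_W: "open (W k)" and zero_W: "0 \<in> W k"
    and uminus_W: "a \<in> W k \<Longrightarrow> - a \<in> W k"
    and add_W: "a \<in> W (Suc k) \<Longrightarrow> b \<in> W (Suc k) \<Longrightarrow> a + b \<in> W k"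
    and base: "open U \<Longrightarrow> 0 \<in> U \<Longrightarrow> \<exists>k. W k \<subseteq> U"
    and open_translation: "open U \<Longrightarrow> open {w. a + w \<in> U}"
begin

lemma W_antimono: "j \<le> k \<Longrightarrow> W k \<subseteq> W j"
proof (induction k rule: dec_induct)
  case (step k)
  have "W (Suc k) \<subseteq> W k" using add_W[OF _ zero_W] by force
  then show ?case using step by blast
qed simp

lemma W_mono: "a \<in> W k \<Longrightarrow> j \<le> k \<Longrightarrow> a \<in> W j"
  using W_antimono by blast

lemma diff_W: "a \<in> W (Suc k) \<Longrightarrow> b \<in> W (Suc k) \<Longrightarrow> a - b \<in> W k"
  using add_W[of a k "- b"] uminus_W by simp

text \<open>The counterpart of summing 2^-(q+j+1) over \<open>j\<close> to at most 2^-q. The first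
  term is split off, and the shifted rest lies in \<open>W (Suc q)\<close> by induction.\<close>

lemma sum_W:
  assumes "\<And>j. j < J \<Longrightarrow> z j \<in> W (q + j + 1)"
  shows "(\<Sum>j<J. z j) \<in> W q"
  using assms
proof (induction J arbitrary: q z)
  case 0
  then show ?case by (simp add: zero_W)
next
  case (Suc J)
  have "(\<Sum>j<J. z (Suc j)) \<in> W (Suc q)"
    by (rule Suc.IH) (use Suc.prems in force)
  then have "z 0 + (\<Sum>j<J. z (Suc j)) \<in> W q"
    using Suc.prems[of 0] by (intro add_W) auto
  then show ?case by (simp add: sum.lessThan_Suc_shift del: sum.lessThan_Suc)
qed

lemma base_at:
  assumes "open U" "a \<in> U"
  obtains k where "\<And>w. w \<in> W k \<Longrightarrow> a + w \<in> U"
  using base[OF open_translation[OF assms(1), of a]] assms(2) by auto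

lemma tendsto_iff_W:
  "(f \<longlongrightarrow> l) F \<longleftrightarrow> (\<forall>k. \<forall>\<^sub>F x in F. f x - l \<in> W k)"
proof (intro iffI allI)
  fix k assume "(f \<longlongrightarrow> l) F"
  moreover have "open {w. - l + w \<in> W k}" by (rule open_translation[OF open_W])
  ultimately have "\<forall>\<^sub>F x in F. f x \<in> {w. - l + w \<in> W k}"
    by (rule topological_tendstoD) (simp add: zero_W)
  then show "\<forall>\<^sub>F x in F. f x - l \<in> W k" by simp
next
  assume *: "\<forall>k. \<forall>\<^sub>F x in F. f x - l \<in> W k"
  show "(f \<longlongrightarrow> l) F"
  proof (rule topological_tendstoI)
    fix U assume "open U" "l \<in> U"
    then obtain k where k: "\<And>w. w \<in> W k \<Longrightarrow> l + w \<in> U" by (rule base_at) blast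
    show "\<forall>\<^sub>F x in F. f x \<in> U"
      using *[THEN spec, of k] by eventually_elim (use k in force)
  qed
qed

lemma tendsto_diff_W:
  fixes f g :: "'b \<Rightarrow> 'a"
  assumes "(f \<longlongrightarrow> l) F" "(g \<longlongrightarrow> m) F"
  shows "((\<lambda>x. f x - g x) \<longlongrightarrow> l - m) F"
  unfolding tendsto_iff_W
proof
  fix k
  have "\<forall>\<^sub>F x in F. f x - l \<in> W (Suc k)" "\<forall>\<^sub>F x in F. g x - m \<in> W (Suc k)"
    using assms unfolding tendsto_iff_W by blast+
  then show "\<forall>\<^sub>F x in F. f x - g x - (l - m) \<in> W k"
  proof eventually_elim
    case (elim x)
    then show ?case using diff_W[OF elim] by (simp add: algebra_simps)
  qed
qed

text \<open>Tails of the geometric series bound the distances, so \<open>v\<close> is Cauchy. The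
  metric \<open>d\<close> is a parameter because the type carries only a topology.\<close>

lemma convergent_of_dist_summable:
  assumes "Metric_space UNIV d" "Metric_space.mcomplete UNIV d"
    and top: "Metric_space.mtopology UNIV d = euclidean"
    and v: "\<And>n. d (v n) (v (Suc n)) < (1/2) ^ n"
  obtains l where "v \<longlonglongrightarrow> (l::'a)"
proof -
  interpret Metric_space UNIV d by fact
  have dist: "d (v m) (v n) \<le> (\<Sum>k=m..<n. (1/2) ^ k)" if "m \<le> n" for m n
    using that
  proof (induction n rule: dec_induct)
    case (step n)
    then show ?case
      using triangle[of "v m" "v n" "v (Suc n)"] v[of n] by simp
  qed simp
  have "MCauchy v"
    unfolding MCauchy_def
  proof (intro conjI allI impI)
    fix e :: real assume "e > 0"
    moreover have "summable (\<lambda>k. (1/2::real) ^ k)"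
      by (rule summable_geometric) simp
    ultimately obtain N where N: "\<And>m n. m \<ge> N \<Longrightarrow> norm (\<Sum>k=m..<n. (1/2::real) ^ k) < e"
      unfolding summable_Cauchy by blast
    have "d (v m) (v n) < e" if "N \<le> m" "m \<le> n" for m n
      using dist[OF that(2)] N[OF that(1), of n] by (simp add: abs_less_iff)
    then show "\<exists>N. \<forall>n n'. N \<le> n \<longrightarrow> N \<le> n' \<longrightarrow> d (v n) (v n') < e"
      by (metis commute linorder_linear)
  qed simp
  then obtain l where "limitin mtopology v l sequentially"
    using assms(2) unfolding mcomplete_def by blast
  then show thesis using top that by simp
qed

text \<open>Klee's theorem: a complete compatible metric need not be translation invariant, so a sequence
  \<open>x\<close> that is Cauchy for the group structure is realised as \<open>x (p k) = v k - u k\<close> where both \<open>v\<close> and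
  \<open>u\<close> are Cauchy for the metric; each step moves \<open>v\<close> and \<open>u\<close> in turn.\<close>
lemma complete:
  assumes cms: "completely_metrizable_space (euclidean :: 'a topology)"
    and Cauchy: "\<And>k. \<exists>M. \<forall>n\<ge>M. \<forall>m\<ge>n. x m - x n \<in> W k"
  obtains l where "x \<longlonglongrightarrow> l"
proof -
  obtain M d where Md: "Metric_space M d" "Metric_space.mcomplete M d"
    "euclidean = Metric_space.mtopology (M :: 'a set) d"
    using cms unfolding completely_metrizable_space_def by blast
  then have "M = UNIV" using Metric_space.topspace_mtopology topspace_euclidean by metis
  note Md = Md[unfolded this]
  interpret Metric_space UNIV d by fact
  \<comment> \<open>Late differences of \<open>x\<close> move a given point \<open>v\<close> by
    little in \<open>d\<close>. How late may depend on \<open>v\<close>, as \<open>d\<close> need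
    not be translation invariant.\<close>
  have near: "\<exists>p\<ge>b. \<forall>m\<ge>p. \<forall>n\<ge>p. d v (v + x m - x n) < e" if "e > 0" for v b e
  proof -
    have "open (mball v e)"
      using openin_mball[of v e] Md(3) by (simp add: open_openin)
    moreover have "v \<in> mball v e" using that by simp
    ultimately obtain k where k: "\<And>w. w \<in> W k \<Longrightarrow> v + w \<in> mball v e"
      by (rule base_at) blast
    obtain M where M: "\<And>n m. n \<ge> M \<Longrightarrow> m \<ge> n \<Longrightarrow> x m - x n \<in> W k" using Cauchy by blast
    have "x m - x n \<in> W k" if "m \<ge> M" "n \<ge> M" for m n
      using M[of m n] M[of n m] that uminus_W[of "x n - x m" k] by (cases "m \<le> n") auto
    then have "d v (v + (x m - x n)) < e" if "m \<ge> M" "n \<ge> M" for m n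
      using k that by auto
    then show ?thesis
      by (intro exI[of _ "max b M"]) (auto simp: add_diff_eq)
  qed
  \<comment> \<open>A state is a pair \<open>(v, p)\<close>. \<open>P\<close> guarantees in advance
    that the next move of \<open>v\<close> is short whichever later index is chosen;
    \<open>Q\<close> says that both \<open>v\<close> and \<open>u = v - x p\<close> move by less
    than \<open>(1/2) ^ k\<close>.\<close>
  define P where "P k s \<longleftrightarrow> (\<forall>m\<ge>snd s. d (fst s) (fst s + x m - x (snd s)) < (1/2) ^ k)"
    for k and s :: "'a \<times> nat"
  define Q where "Q k s t \<longleftrightarrow> d (fst s) (fst t) < (1/2) ^ k \<and>
      d (fst s - x (snd s)) (fst t - x (snd t)) < (1/2) ^ k \<and> snd s < snd t"
    for k :: nat and s t :: "'a \<times> nat"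
  have "\<exists>f. \<forall>k. P k (f k) \<and> Q k (f k) (f (Suc k))"
  proof (rule dependent_nat_choice)
    show "\<exists>s. P 0 s"
    proof -
      obtain n where "\<And>m. m \<ge> n \<Longrightarrow> d 0 (0 + x m - x n) < 1"
        using near[of 1 0 0] by auto
      then have "P 0 (0, n)" by (simp add: P_def)
      then show ?thesis by blast
    qed
  next
    fix s k assume s: "P k s"
    obtain v n where vn: "s = (v, n)" by fastforce
    obtain n' where n': "n' \<ge> Suc n" "\<And>m l. m \<ge> n' \<Longrightarrow> l \<ge> n' \<Longrightarrow> d (v - x n) (v - x n + x m - x l) < (1/2) ^ k"
      using near[of "(1/2) ^ k" "Suc n" "v - x n"] by auto
    \<comment> \<open>This move keeps \<open>u\<close>, since \<open>v' - x n' = v - x n\<close>.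
      Passing from \<open>n'\<close> to \<open>n''\<close> then keeps \<open>v'\<close> and changes
      only \<open>u\<close>, by a small amount thanks to the choice of \<open>n'\<close>.\<close>
    define v' where "v' = v + x n' - x n"
    obtain n'' where n'': "n'' \<ge> n'" "\<And>m. m \<ge> n'' \<Longrightarrow> d v' (v' + x m - x n'') < (1/2) ^ Suc k"
      using near[of "(1/2) ^ Suc k" n' v'] by auto
    have "d v v' < (1/2) ^ k"
      using s n'(1) by (simp add: P_def vn v'_def)
    moreover have "d (v - x n) (v' - x n'') < (1/2) ^ k"
      using n'(2)[of n' n''] n''(1) by (simp add: v'_def algebra_simps)
    ultimately show "\<exists>t. P (Suc k) t \<and> Q k s t"
      using n'' n'(1) by (intro exI[of _ "(v', n'')"]) (auto simp: P_def Q_def vn)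
  qed
  then obtain f where f: "\<And>k. Q k (f k) (f (Suc k))" by blast
  define p where "p k = snd (f k)" for k
  obtain v where v: "(\<lambda>k. fst (f k)) \<longlonglongrightarrow> v"
    using convergent_of_dist_summable[OF Md(1,2) Md(3)[symmetric], of "\<lambda>k. fst (f k)"] f
    unfolding Q_def by blast
  obtain u where u: "(\<lambda>k. fst (f k) - x (p k)) \<longlonglongrightarrow> u"
    using convergent_of_dist_summable[OF Md(1,2) Md(3)[symmetric], of "\<lambda>k. fst (f k) - x (p k)"] f
    unfolding Q_def p_def by blast
  have lim: "(\<lambda>k. x (p k)) \<longlonglongrightarrow> v - u"
    using tendsto_diff_W[OF v u] by simp
  have p: "strict_mono p"
    using f by (auto simp: strict_mono_Suc_iff p_def Q_def)
  have "x \<longlonglongrightarrow> v - u"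
    unfolding tendsto_iff_W
  proof
    fix k
    obtain M where M: "\<And>n m. n \<ge> M \<Longrightarrow> m \<ge> n \<Longrightarrow> x m - x n \<in> W (Suc k)" using Cauchy by blast
    have "\<forall>\<^sub>F j in sequentially. x (p j) - (v - u) \<in> W (Suc k) \<and> M \<le> j"
      using lim[unfolded tendsto_iff_W] eventually_ge_at_top[of M]
      by (auto intro: eventually_conj)
    then obtain j where j: "x (p j) - (v - u) \<in> W (Suc k)" "M \<le> j"
      by (auto dest: eventually_happens)
    have "p j \<ge> M" using j(2) seq_suble[OF p, of j] by linarith
    show "\<forall>\<^sub>F n in sequentially. x n - (v - u) \<in> W k"
      using eventually_ge_at_top[of "p j"]
    proof eventually_elim
      case (elim n)
      then have "x n - x (p j) \<in> W (Suc k)" using M \<open>p j \<ge> M\<close> by blast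
      then have "x n - x (p j) + (x (p j) - (v - u)) \<in> W k" using add_W[OF _ j(1)] by blast
      then show ?case by (simp add: algebra_simps)
    qed
  qed
  then show thesis by (rule that)
qed

end

text \<open>Continuity of addition at \<open>(0, 0)\<close> gives the halving property, intersecting
  with the reflected set gives symmetry, and shrinking into the metric balls \<open>B k\<close>
  makes the sequence a base.\<close>

lemma zero_base_exists:
  assumes "polish_tvs TYPE('a::{real_vector, topological_space})"
  obtains W :: "nat \<Rightarrow> 'a::{real_vector, topological_space} set" where "zero_base W"
proof -
  have add: "continuous_on UNIV (\<lambda>p::'a \<times> 'a. fst p + snd p)"
    and scale: "continuous_on UNIV (\<lambda>p::real \<times> 'a. fst p *\<^sub>R snd p)"
    and cms: "completely_metrizable_space (euclidean :: 'a topology)"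
    using assms by (auto simp: polish_tvs_def)
  have transl: "open {w. a + w \<in> U}" if "open U" for a :: 'a and U
  proof -
    have "continuous_on UNIV (\<lambda>w. fst (a, w) + snd (a, w))"
      by (rule continuous_on_compose2[OF add]) (auto intro: continuous_intros)
    then show ?thesis using that open_vimage[of U "\<lambda>w. a + w"] by (simp add: vimage_def)
  qed
  have neg: "open {w. - w \<in> U}" if "open U" for U :: "'a set"
  proof -
    have "continuous_on UNIV (\<lambda>w::'a. fst (-1::real, w) *\<^sub>R snd (-1::real, w))"
      by (rule continuous_on_compose2[OF scale]) (auto intro: continuous_intros)
    then show ?thesis using that open_vimage[of U "\<lambda>w. - w"] by (simp add: vimage_def)
  qed
  obtain M d where Md: "Metric_space M d" "euclidean = Metric_space.mtopology (M :: 'a set) d"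
    using cms unfolding completely_metrizable_space_def by blast
  then have "M = UNIV" using Metric_space.topspace_mtopology topspace_euclidean by metis
  note Md = Md[unfolded this]
  interpret Metric_space UNIV d by fact
  have open_ball: "open (mball v e)" for v e
    using openin_mball[of v e] Md(2) by (simp add: open_openin)
  define B where "B k = mball (0::'a) ((1/2) ^ k)" for k
  define P where "P k V \<longleftrightarrow> open V \<and> 0 \<in> V \<and> V \<subseteq> B k \<and> (\<forall>a\<in>V. - a \<in> V)" for k V
  have sym: "\<exists>V. P k V \<and> V \<subseteq> U" if "open U" "0 \<in> U" for k U
  proof -
    have "open (U \<inter> B k)"
      using that open_ball by (simp add: B_def open_Int)
    moreover have "0 \<in> U \<inter> B k" using that by (simp add: B_def)
    ultimately have "P k (U \<inter> B k \<inter> {w. - w \<in> U \<inter> B k})"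
      using open_Int[OF _ neg[of "U \<inter> B k"], of "U \<inter> B k"] unfolding P_def by auto
    then show ?thesis by blast
  qed
  have "\<exists>W. \<forall>k. P k (W k) \<and> (\<forall>a\<in>W (Suc k). \<forall>b\<in>W (Suc k). a + b \<in> W k)"
  proof (rule dependent_nat_choice)
    show "\<exists>V. P 0 V" using sym[of UNIV] by auto
  next
    fix V k assume V: "P k V"
    have "open ((\<lambda>p::'a \<times> 'a. fst p + snd p) -` V)"
      by (rule open_vimage[OF _ add]) (use V in \<open>simp add: P_def\<close>)
    moreover have "(0, 0) \<in> (\<lambda>p::'a \<times> 'a. fst p + snd p) -` V"
      using V by (simp add: P_def)
    ultimately obtain A B where AB: "open A" "open B" "(0, 0) \<in> A \<times> B"
      "A \<times> B \<subseteq> (\<lambda>p::'a \<times> 'a. fst p + snd p) -` V"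
      by (rule open_prod_elim)
    obtain V' where "P (Suc k) V'" "V' \<subseteq> A \<inter> B"
      using sym[of "A \<inter> B" "Suc k"] AB by auto
    then show "\<exists>V'. P (Suc k) V' \<and> (\<forall>a\<in>V'. \<forall>b\<in>V'. a + b \<in> V)"
      using AB(4) by (intro exI[of _ V']) fastforce
  qed
  then obtain W where W: "\<And>k. P k (W k)" "\<And>k a b. a \<in> W (Suc k) \<Longrightarrow> b \<in> W (Suc k) \<Longrightarrow> a + b \<in> W k"
    by blast
  show thesis
  proof (rule that, unfold_locales)
    fix U :: "'a set" assume "open U" "0 \<in> U"
    then obtain r where r: "r > 0" "mball 0 r \<subseteq> U"
      using openin_mtopology[of U] Md(2) by (auto simp: open_openin)
    obtain k where "(1/2) ^ k < r"
      using real_arch_pow_inv[OF r(1), of "1/2"] by auto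
    then have "B k \<subseteq> U" using r(2) by (auto simp: B_def)
    then show "\<exists>k. W k \<subseteq> U" using W(1)[of k] by (auto simp: P_def)
  qed (use W transl in \<open>auto simp: P_def\<close>)
qed

subsection \<open>Unconditional convergence\<close>

text \<open>The blocks partition the natural numbers, so each can be permuted on its own with
  \<open>F k\<close> moved to its front. A sum over \<open>F k\<close> then becomes a difference of
  two partial sums of the rearranged series.\<close>

lemma block_permutation:
  fixes b :: "nat \<Rightarrow> nat"
  assumes b: "strict_mono b" "b 0 = 0" and F: "\<And>k. F k \<subseteq> {b k..<b (Suc k)}"
  obtains \<sigma> where "bij \<sigma>" "\<And>k. \<sigma> ` {b k..<b k + card (F k)} = F k"
proof -
  let ?B = "\<lambda>k. {b k..<b (Suc k)}"
  have "\<exists>\<pi>. bij_betw \<pi> (?B k) (?B k) \<and> \<pi> ` {b k..<b k + card (F k)} = F k" for k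
  proof -
    let ?I = "{b k..<b k + card (F k)}" and ?J = "{b k + card (F k)..<b (Suc k)}"
    have fin: "finite (F k)" using F finite_subset by blast
    have le: "card (F k) \<le> b (Suc k) - b k"
      using card_mono[OF _ F, of k] by simp
    have "b k < b (Suc k)" using b(1) by (simp add: strict_mono_Suc_iff)
    then have un: "?I \<union> ?J = ?B k" using le by (intro ivl_disj_un) auto
    obtain \<pi>1 where 1: "bij_betw \<pi>1 ?I (F k)"
      using finite_same_card_bij[of ?I "F k"] fin by auto
    obtain \<pi>2 where 2: "bij_betw \<pi>2 ?J (?B k - F k)"
      using finite_same_card_bij[of ?J "?B k - F k"] fin F[of k] by (auto simp: card_Diff_subset)
    let ?\<pi> = "\<lambda>n. if n \<in> ?I then \<pi>1 n else \<pi>2 n"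
    have "bij_betw ?\<pi> ?I (F k)"
      using 1 by (subst bij_betw_cong[of _ _ \<pi>1]) auto
    moreover have "bij_betw ?\<pi> ?J (?B k - F k)"
      using 2 by (subst bij_betw_cong[of _ _ \<pi>2]) auto
    ultimately have "bij_betw ?\<pi> (?I \<union> ?J) (F k \<union> (?B k - F k))"
      by (rule bij_betw_combine) auto
    moreover have "F k \<union> (?B k - F k) = ?B k" using F by blast
    ultimately show ?thesis
      using un \<open>bij_betw ?\<pi> ?I (F k)\<close> by (intro exI[of _ ?\<pi>]) (simp add: bij_betw_def)
  qed
  then obtain \<pi> where \<pi>: "\<And>k. bij_betw (\<pi> k) (?B k) (?B k)"
    "\<And>k. \<pi> k ` {b k..<b k + card (F k)} = F k"
    by metis
  have "\<exists>k. n \<in> ?B k" for n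
  proof -
    define k where "k = (LEAST k. n < b (Suc k))"
    have "n < b (Suc n)" using seq_suble[OF b(1), of "Suc n"] by linarith
    then have 1: "n < b (Suc k)" unfolding k_def by (rule LeastI)
    have "b k \<le> n"
    proof (cases k)
      case (Suc j)
      then have "\<not> n < b (Suc j)" using not_less_Least[of j "\<lambda>k. n < b (Suc k)"] by (simp add: k_def)
      then show ?thesis using Suc by simp
    qed (use b(2) in simp)
    then show ?thesis using 1 by auto
  qed
  then obtain idx where idx: "\<And>n. n \<in> ?B (idx n)" by metis
  have uniq: "j = k" if "n \<in> ?B j" "n \<in> ?B k" for n j k
  proof -
    have "b j < b (Suc k)" "b k < b (Suc j)" using that by auto
    then show ?thesis using b(1) by (simp add: strict_mono_less)
  qed
  define \<sigma> where "\<sigma> n = \<pi> (idx n) n" for n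
  have \<sigma>_eq: "\<sigma> n = \<pi> k n" if "n \<in> ?B k" for n k
    using uniq[OF idx that] by (simp add: \<sigma>_def)
  have \<sigma>_in: "\<sigma> n \<in> ?B (idx n)" for n
    using \<pi>(1)[of "idx n"] idx[of n] unfolding \<sigma>_def by (rule bij_betw_apply)
  have "inj \<sigma>"
  proof (rule injI)
    fix m n assume eq: "\<sigma> m = \<sigma> n"
    then have "idx m = idx n" using uniq \<sigma>_in by metis
    then show "m = n"
      using eq idx \<pi>(1) unfolding \<sigma>_def by (metis bij_betw_imp_inj_on inj_onD)
  qed
  moreover have "y \<in> range \<sigma>" for y
  proof -
    obtain x where "x \<in> ?B (idx y)" "y = \<pi> (idx y) x"
      using \<pi>(1)[of "idx y"] idx[of y] unfolding bij_betw_def by blast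
    then show ?thesis using \<sigma>_eq by (metis rangeI)
  qed
  ultimately have "bij \<sigma>" by (auto simp: bij_def)
  moreover have "\<sigma> ` {b k..<b k + card (F k)} = F k" for k
  proof -
    have "card (F k) \<le> b (Suc k) - b k" using card_mono[OF _ F, of k] by simp
    then have "\<sigma> ` {b k..<b k + card (F k)} = \<pi> k ` {b k..<b k + card (F k)}"
      by (intro image_cong \<sigma>_eq) auto
    then show ?thesis by (simp add: \<pi>(2))
  qed
  ultimately show thesis by (rule that)
qed

context zero_base
begin

text \<open>If arbitrarily late finite sums stay away from zero, a rearrangement listing disjoint such
  sets consecutively has partial sums that are not Cauchy.\<close>
lemma uncond_convergent_tails:
  assumes "uncond_convergent f"
  obtains N where "\<And>F. finite F \<Longrightarrow> F \<subseteq> {N..} \<Longrightarrow> sum f F \<in> W k"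
proof (rule ccontr)
  assume "\<not> thesis"
  with that have far: "\<exists>F. finite F \<and> F \<subseteq> {N..} \<and> sum f F \<notin> W k" for N
    by blast
  \<comment> \<open>The clause for \<open>n = 0\<close> fixes the start of the chosen sequence, so
    that the blocks leave no gap at the beginning.\<close>
  have "\<exists>b. \<forall>n. (n = 0 \<longrightarrow> b n = 0) \<and>
      (b n < b (Suc n) \<and> (\<exists>F. F \<subseteq> {b n..<b (Suc n)} \<and> sum f F \<notin> W k))"
  proof (rule dependent_nat_choice)
    fix N n :: nat
    obtain F where F: "finite F" "F \<subseteq> {N..}" "sum f F \<notin> W k" using far by blast
    have "F \<subseteq> {N..<Suc (max N (Max F))}"
      using F(1,2) by (auto simp: less_Suc_eq_le le_max_iff_disj)
    then show "\<exists>M. (Suc n = 0 \<longrightarrow> M = 0) \<and> N < M \<and> (\<exists>F\<subseteq>{N..<M}. sum f F \<notin> W k)"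
      using F(3) by (intro exI[of _ "Suc (max N (Max F))"]) auto
  qed simp
  then obtain b where b: "b 0 = 0" "\<And>n. b n < b (Suc n)"
    "\<And>n. \<exists>F. F \<subseteq> {b n..<b (Suc n)} \<and> sum f F \<notin> W k"
    by blast
  then obtain F where F: "\<And>n. F n \<subseteq> {b n..<b (Suc n)}" "\<And>n. sum f (F n) \<notin> W k"
    by metis
  have sm: "strict_mono b" using b(2) by (simp add: strict_mono_Suc_iff)
  obtain \<sigma> where \<sigma>: "bij \<sigma>" "\<And>n. \<sigma> ` {b n..<b n + card (F n)} = F n"
    using block_permutation[OF sm b(1) F(1)] by blast
  define s where "s n = (\<Sum>i<n. f (\<sigma> i))" for n
  obtain l where l: "s \<longlonglongrightarrow> l"
    using assms \<sigma>(1) unfolding uncond_convergent_def sums_def s_def by blast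
  have fb: "filterlim b at_top sequentially" using sm by (rule filterlim_subseq)
  then have fb': "filterlim (\<lambda>n. b n + card (F n)) at_top sequentially"
    by (rule filterlim_at_top_mono) auto
  \<comment> \<open>Both sequences of partial sums tend to \<open>l\<close>, yet their difference is
    \<open>sum f (F n)\<close>, which avoids \<open>W k\<close>.\<close>
  have "(\<lambda>n. s (b n + card (F n)) - s (b n)) \<longlonglongrightarrow> l - l"
    by (intro tendsto_diff_W filterlim_compose[OF l] fb fb')
  moreover have "s (b n + card (F n)) - s (b n) = sum f (F n)" for n
  proof -
    have "s (b n + card (F n)) - s (b n) = (\<Sum>i=b n..<b n + card (F n). f (\<sigma> i))"
      using sum.atLeastLessThan_concat[of 0 "b n" "b n + card (F n)" "\<lambda>i. f (\<sigma> i)"]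
      by (simp add: s_def atLeast0LessThan algebra_simps)
    also have "\<dots> = sum f (\<sigma> ` {b n..<b n + card (F n)})"
      using \<sigma>(1) by (subst sum.reindex) (auto simp: bij_def inj_on_def)
    finally show ?thesis by (simp add: \<sigma>(2))
  qed
  ultimately have "\<forall>\<^sub>F n in sequentially. sum f (F n) \<in> W k"
    unfolding tendsto_iff_W by auto
  then show False using F(2) by (auto dest: eventually_happens)
qed

end

subsection \<open>Frequent hypercyclicity\<close>

text \<open>The terms are grouped by \<open>j = c n\<close>. Each group is a sum of
  \<open>h j\<close> over a finite set beyond \<open>N (max k j)\<close>, hence lies in
  \<open>W (q k + j + 1)\<close>, and \<open>sum_W\<close> adds the groups. This serves for tails of
  the series with \<open>g n = n\<close>, and for the errors with \<open>g n = m - n\<close> or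
  \<open>g n = n - m\<close>.\<close>

lemma separated_sum_mem_W:
  assumes "zero_base W" and q: "mono q" and N: "mono N"
    and tails: "\<And>i j F. j \<le> i \<Longrightarrow> finite F \<Longrightarrow> F \<subseteq> {N i..} \<Longrightarrow> sum (h j) F \<in> W (q i + i + 1)"
    and F: "finite F" "inj_on g F" "\<And>n. n \<in> F \<Longrightarrow> N (max k (c n)) \<le> g n"
  shows "(\<Sum>n\<in>F. h (c n) (g n :: nat)) \<in> W (q k)"
proof -
  interpret zero_base W by fact
  obtain J where J: "c ` F \<subseteq> {..<J}"
    using F(1) finite_nat_bounded[of "c ` F"] by auto
  have "(\<Sum>n\<in>{n\<in>F. c n = j}. h (c n) (g n)) \<in> W (q k + j + 1)" for j
  proof -
    have "(\<Sum>n\<in>{n\<in>F. c n = j}. h (c n) (g n)) = (\<Sum>n\<in>{n\<in>F. c n = j}. h j (g n))"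
      by (rule sum.cong) auto
    also have "\<dots> = sum (h j) (g ` {n\<in>F. c n = j})"
      using F(2) by (subst sum.reindex) (auto intro: inj_on_subset)
    also have "\<dots> \<in> W (q (max k j) + max k j + 1)"
      by (rule tails) (use F in auto)
    finally show ?thesis
      by (rule W_mono) (use monoD[OF q, of k "max k j"] in auto)
  qed
  then have "(\<Sum>j<J. \<Sum>n\<in>{n\<in>F. c n = j}. h (c n) (g n)) \<in> W (q k)"
    by (intro sum_W)
  then show ?thesis
    using sum.group[OF F(1) _ J, of "\<lambda>n. h (c n) (g n)"] by simp
qed

section \<open>Powers of \<open>T\<close> against powers of its right inverse
  \<open>S\<close>\<close>

lemma funpow_right_inverse:
  assumes "S ` D \<subseteq> D" "\<And>x. x \<in> D \<Longrightarrow> T (S x) = x" "y \<in> D"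
  shows "(S ^^ n) y \<in> D" "(T ^^ n) ((S ^^ n) y) = y"
proof -
  show D: "(S ^^ n) y \<in> D" for n
    by (induction n) (use assms in auto)
  show "(T ^^ n) ((S ^^ n) y) = y"
    by (induction n) (simp_all add: funpow_swap1[of T] D assms(2) flip: funpow_swap1)
qed

lemma funpow_funpow_right_inverse:
  assumes "S ` D \<subseteq> D" "\<And>x. x \<in> D \<Longrightarrow> T (S x) = x" "y \<in> D"
  shows "(T ^^ m) ((S ^^ n) y) = (if m \<le> n then (S ^^ (n - m)) y else (T ^^ (m - n)) y)"
proof (cases "m \<le> n")
  case True
  then have "(S ^^ n) y = (S ^^ m) ((S ^^ (n - m)) y)"
    by (metis comp_apply funpow_add le_add_diff_inverse)
  then show ?thesis
    using True funpow_right_inverse[OF assms(1,2)] assms(3) by simp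
next
  case False
  then have "(T ^^ m) ((S ^^ n) y) = (T ^^ (m - n)) ((T ^^ n) ((S ^^ n) y))"
    by (metis comp_apply funpow_add le_add_diff_inverse2 nat_le_linear)
  then show ?thesis
    using False funpow_right_inverse[OF assms] by simp
qed

theorem theorem2p1:
  fixes T :: "'a::{real_vector, topological_space} \<Rightarrow> 'a"
  assumes "polish_tvs TYPE('a)"
    and "infinite_dimensional TYPE('a)"
    and "cont_linear_op T"
    and "freq_hc_criterion T"
  shows "hered_freq_hypercyclic T"
proof -
  obtain W :: "nat \<Rightarrow> 'a set" where W: "zero_base W"
    using zero_base_exists[OF assms(1)] by blast
  interpret zero_base W by fact
  have cms: "completely_metrizable_space (euclidean :: 'a topology)"
    using assms(1) by (simp add: polish_tvs_def)
  have linT: "linear (T ^^ m)" for m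
  proof (induction m)
    case (Suc m)
    then show ?case
      using assms(3) linear_compose[of "T ^^ m" T] by (simp add: cont_linear_op_def o_def)
  qed (simp add: linear_id[unfolded id_def])
  have contT: "continuous_on UNIV (T ^^ m)" for m
  proof (induction m)
    case (Suc m)
    then show ?case
      using assms(3) continuous_on_compose[of UNIV "T ^^ m" T]
      by (auto simp: cont_linear_op_def intro: continuous_on_subset)
  qed (simp add: id_def)
  obtain D S where D: "closure D = UNIV" "S ` D \<subseteq> D" "\<And>x. x \<in> D \<Longrightarrow> T (S x) = x"
    and uncond: "\<And>x. x \<in> D \<Longrightarrow> uncond_convergent (\<lambda>n. (T ^^ n) x)"
      "\<And>x. x \<in> D \<Longrightarrow> uncond_convergent (\<lambda>n. (S ^^ n) x)"
    using assms(4) unfolding freq_hc_criterion_def by blast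
  have main: "\<exists>l. \<forall>i. lower_density (return_set T l (V i) \<inter> A i) > 0"
    if V: "\<And>i. open (V i)" "\<And>i. V i \<noteq> {}" and A: "\<And>i. lower_density (A i) > 0"
    for V :: "nat \<Rightarrow> 'a set" and A
  proof -
    have "\<exists>x. x \<in> D \<and> x \<in> V i" for i
      using V[of i] D(1) open_Int_closure_eq_empty[of "V i" D] by auto
    then obtain x where x: "\<And>i. x i \<in> D" "\<And>i. x i \<in> V i" by metis
    have "\<exists>t. \<forall>w\<in>W t. x i + w \<in> V i" for i
      using base_at[OF V(1) x(2)] by metis
    then obtain t where t: "\<And>i w. w \<in> W (t i) \<Longrightarrow> x i + w \<in> V i" by metis
    \<comment> \<open>The summand \<open>i\<close> makes \<open>W (q i)\<close> shrink into
      \<open>W i\<close> for the Cauchy property, 2 pays for the two additions that join three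
      errors into \<open>W (t i)\<close>, and the sum over \<open>t\<close> makes \<open>q\<close>
      monotone.\<close>
    define q where "q i = i + 2 + (\<Sum>j\<le>i. t j)" for i
    have q: "mono q" by (auto simp: mono_iff_le_Suc q_def)
    have q_ge: "k \<le> q k" "Suc (Suc (t k)) \<le> q k" for k
      using member_le_sum[of k "{..k}" t] by (auto simp: q_def)
    \<comment> \<open>One threshold serves all \<open>j \<le> i\<close>. The precision
      \<open>q i + i + 1\<close> is what \<open>separated_sum_mem_W\<close> uses at
      \<open>i = max k j\<close>, leaving room to sum over \<open>j\<close>.\<close>
    have "\<exists>N. \<forall>j F. j \<le> i \<longrightarrow> finite F \<longrightarrow> F \<subseteq> {N..} \<longrightarrow>
        (\<Sum>n\<in>F. (S ^^ n) (x j)) \<in> W (q i + i + 1) \<and> (\<Sum>n\<in>F. (T ^^ n) (x j)) \<in> W (q i + i + 1)" for i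
    proof -
      have "\<exists>N. \<forall>F. finite F \<longrightarrow> F \<subseteq> {N..} \<longrightarrow>
        (\<Sum>n\<in>F. (S ^^ n) (x j)) \<in> W (q i + i + 1) \<and> (\<Sum>n\<in>F. (T ^^ n) (x j)) \<in> W (q i + i + 1)" for j
      proof -
        obtain N1 where N1: "\<And>F. finite F \<Longrightarrow> F \<subseteq> {N1..} \<Longrightarrow> (\<Sum>n\<in>F. (S ^^ n) (x j)) \<in> W (q i + i + 1)"
          using uncond_convergent_tails[OF uncond(2)[OF x(1)]] by metis
        obtain N2 where N2: "\<And>F. finite F \<Longrightarrow> F \<subseteq> {N2..} \<Longrightarrow> (\<Sum>n\<in>F. (T ^^ n) (x j)) \<in> W (q i + i + 1)"
          using uncond_convergent_tails[OF uncond(1)[OF x(1)]] by metis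
        have "{max N1 N2..} \<subseteq> {N1..}" "{max N1 N2..} \<subseteq> {N2..}" by auto
        then show ?thesis
          using N1 N2 by (intro exI[of _ "max N1 N2"]) (meson order_trans)
      qed
      then obtain n where n: "\<And>j F. finite F \<Longrightarrow> F \<subseteq> {n j..} \<Longrightarrow>
        (\<Sum>n\<in>F. (S ^^ n) (x j)) \<in> W (q i + i + 1) \<and> (\<Sum>n\<in>F. (T ^^ n) (x j)) \<in> W (q i + i + 1)"
        by metis
      have "{\<Sum>j\<le>i. n j..} \<subseteq> {n j..}" if "j \<le> i" for j
        using member_le_sum[of j "{..i}" n] that by auto
      then show ?thesis
        using n by (intro exI[of _ "\<Sum>j\<le>i. n j"]) (meson order_trans)
    qed
    then obtain N0 where N0: "\<And>i j F. j \<le> i \<Longrightarrow> finite F \<Longrightarrow> F \<subseteq> {N0 i..} \<Longrightarrow>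
        (\<Sum>n\<in>F. (S ^^ n) (x j)) \<in> W (q i + i + 1) \<and> (\<Sum>n\<in>F. (T ^^ n) (x j)) \<in> W (q i + i + 1)"
      by metis
    define N where "N i = (\<Sum>j\<le>i. N0 j)" for i
    have N: "mono N" by (auto simp: mono_iff_le_Suc N_def)
    have "{N i..} \<subseteq> {N0 i..}" for i
      using member_le_sum[of i "{..i}" N0] by (auto simp: N_def)
    then have tails: "(\<Sum>n\<in>F. (S ^^ n) (x j)) \<in> W (q i + i + 1)" "(\<Sum>n\<in>F. (T ^^ n) (x j)) \<in> W (q i + i + 1)"
      if "j \<le> i" "finite F" "F \<subseteq> {N i..}" for i j F
      using N0[of j i F] that by (meson order_trans)+
    obtain E where E: "\<And>i. E i \<subseteq> A i" "\<And>i. lower_density (E i) > 0"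
      "\<And>i n. n \<in> E i \<Longrightarrow> N i \<le> n"
      "\<And>i j n. n \<in> E i \<Longrightarrow> n \<in> E j \<Longrightarrow> i = j"
      "\<And>i j m n. m \<in> E i \<Longrightarrow> n \<in> E j \<Longrightarrow> m < n \<Longrightarrow> N (max i j) \<le> n - m"
      using separated_subsets[of A N, OF A N] by blast
    define U where "U = (\<Union>i. E i)"
    \<comment> \<open>The sets \<open>E i\<close> are disjoint, so \<open>c n\<close> is the only
      index of \<open>n\<close>, and the double series becomes a single series over
      \<open>U\<close>.\<close>
    have "\<exists>c. \<forall>n\<in>U. n \<in> E (c n)" unfolding U_def by (intro bchoice) auto
    then obtain c where c: "\<And>n. n \<in> U \<Longrightarrow> n \<in> E (c n)" by blast
    have c_eq: "c m = i" "m \<in> U" if "m \<in> E i" for m i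
      using that c E(4) unfolding U_def by blast+
    note smallS = separated_sum_mem_W[OF W q N, of "\<lambda>j n. (S ^^ n) (x j)" _ _ _ c, OF tails(1)]
    note smallT = separated_sum_mem_W[OF W q N, of "\<lambda>j n. (T ^^ n) (x j)" _ _ _ c, OF tails(2)]
    define s where "s M = (\<Sum>n\<in>U \<inter> {..<M}. (S ^^ n) (x (c n)))" for M
    have "\<exists>M. \<forall>n\<ge>M. \<forall>m\<ge>n. s m - s n \<in> W k" for k
    proof (intro exI[of _ "N k"] allI impI)
      fix n m assume nm: "N k \<le> n" "n \<le> m"
      have un: "U \<inter> {..<m} = U \<inter> {..<n} \<union> U \<inter> {n..<m}" using nm by auto
      have "s m - s n = (\<Sum>n\<in>U \<inter> {n..<m}. (S ^^ n) (x (c n)))"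
        unfolding s_def un by (subst sum.union_disjoint) auto
      also have "\<dots> \<in> W (q k)"
      proof (rule smallS)
        fix n' assume n': "n' \<in> U \<inter> {n..<m}"
        then have "N (c n') \<le> n'" "N k \<le> n'" using nm c E(3) by auto
        then show "N (max k (c n')) \<le> n'" by (simp add: max_def)
      qed auto
      finally show "s m - s n \<in> W k" using q_ge(1) by (rule W_mono)
    qed
    then obtain l where l: "s \<longlonglongrightarrow> l" by (rule complete[OF cms])
    have "E i \<subseteq> return_set T l (V i) \<inter> A i" for i
    proof
      fix m assume m: "m \<in> E i"
      have "(\<lambda>M. (T ^^ m) (s M)) \<longlonglongrightarrow> (T ^^ m) l"
        by (rule continuous_on_tendsto_compose[OF contT l]) auto
      \<comment> \<open>Linearity applies to finite sums only, so a partial sum stands in for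
        \<open>l\<close>, at the price of one more small error. \<open>m < M\<close> ensures that
        the term producing \<open>x i\<close> is included.\<close>
      then have "\<forall>\<^sub>F M in sequentially. (T ^^ m) (s M) - (T ^^ m) l \<in> W (q i) \<and> m < M"
        unfolding tendsto_iff_W using eventually_gt_at_top[of m] by (auto intro: eventually_conj)
      then obtain M where M: "(T ^^ m) (s M) - (T ^^ m) l \<in> W (q i)" "m < M"
        by (auto dest: eventually_happens)
      define f where "f n = (T ^^ m) ((S ^^ n) (x (c n)))" for n
      have f: "f n = (if m \<le> n then (S ^^ (n - m)) (x (c n)) else (T ^^ (m - n)) (x (c n)))" for n
        unfolding f_def by (rule funpow_funpow_right_inverse[OF D(2,3) x(1)])
      have "(T ^^ m) (s M) = sum f (U \<inter> {..<M})"
        unfolding s_def f_def by (rule linear_sum[OF linT])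
      also have "U \<inter> {..<M} = insert m (U \<inter> {..<m} \<union> U \<inter> {m<..<M})"
        using M(2) c_eq[OF m] by auto
      also have "sum f \<dots> = f m + (sum f (U \<inter> {..<m}) + sum f (U \<inter> {m<..<M}))"
        by (subst sum.insert, simp, simp, subst sum.union_disjoint) auto
      also have "f m = x i" using c_eq[OF m] f[of m] by simp
      finally have split: "(T ^^ m) (s M) = x i + (sum f (U \<inter> {..<m}) + sum f (U \<inter> {m<..<M}))" .
      have "sum f (U \<inter> {..<m}) = (\<Sum>n\<in>U \<inter> {..<m}. (T ^^ (m - n)) (x (c n)))"
        by (rule sum.cong) (auto simp: f)
      also have "\<dots> \<in> W (q i)"
      proof (rule smallT)
        fix n assume "n \<in> U \<inter> {..<m}"
        then show "N (max i (c n)) \<le> m - n"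
          using E(5)[OF c m, of n] by (simp add: max.commute)
      qed (auto simp: inj_on_def)
      finally have left: "sum f (U \<inter> {..<m}) \<in> W (q i)" .
      have "sum f (U \<inter> {m<..<M}) = (\<Sum>n\<in>U \<inter> {m<..<M}. (S ^^ (n - m)) (x (c n)))"
        by (rule sum.cong) (auto simp: f)
      also have "\<dots> \<in> W (q i)"
      proof (rule smallS)
        fix n assume "n \<in> U \<inter> {m<..<M}"
        then show "N (max i (c n)) \<le> n - m"
          using E(5)[OF m c, of n] by simp
      qed (auto simp: inj_on_def)
      finally have right: "sum f (U \<inter> {m<..<M}) \<in> W (q i)" .
      note mono = W_mono[OF _ q_ge(2)[of i]]
      have "sum f (U \<inter> {..<m}) + sum f (U \<inter> {m<..<M}) \<in> W (Suc (t i))"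
        using left right by (intro add_W mono)
      moreover have "(T ^^ m) (s M) - (T ^^ m) l \<in> W (Suc (t i))"
        using M(1) mono W_antimono[of "Suc (t i)" "Suc (Suc (t i))"] by auto
      ultimately have "sum f (U \<inter> {..<m}) + sum f (U \<inter> {m<..<M}) - ((T ^^ m) (s M) - (T ^^ m) l) \<in> W (t i)"
        by (rule diff_W)
      \<comment> \<open>Adding \<open>x i\<close> to the combined error gives exactly
        \<open>(T ^^ m) l\<close>, because the partial sum cancels.\<close>
      from t[OF this] have "(T ^^ m) l \<in> V i" unfolding split by simp
      then show "m \<in> return_set T l (V i) \<inter> A i"
        using m E(1) by (auto simp: return_set_def)
    qed
    then have "lower_density (return_set T l (V i) \<inter> A i) > 0" for i
      using E(2)[of i] lower_density_mono order_less_le_trans by blast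
    then show ?thesis by blast
  qed
  have UNIV_pos: "lower_density UNIV > 0"
    unfolding lower_density_pos_iff by (intro exI[of _ 1]) simp
  show ?thesis
    unfolding hered_freq_hypercyclic_def
  proof (intro allI impI)
    fix I :: "nat set" and V :: "nat \<Rightarrow> 'a set" and A :: "nat \<Rightarrow> nat set"
    assume *: "\<forall>i\<in>I. open (V i) \<and> V i \<noteq> {} \<and> lower_density (A i) > 0"
    \<comment> \<open>Indices outside \<open>I\<close> receive trivial data, so that
      \<open>main\<close>, which is stated for all natural numbers as indices, applies.\<close>
    define V' where "V' i = (if i \<in> I then V i else UNIV)" for i
    define A' where "A' i = (if i \<in> I then A i else UNIV)" for i
    have "\<exists>l. \<forall>i. lower_density (return_set T l (V' i) \<inter> A' i) > 0"
      by (rule main) (use * UNIV_pos in \<open>simp_all add: V'_def A'_def\<close>)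
    then obtain l where l: "\<And>i. lower_density (return_set T l (V' i) \<inter> A' i) > 0"
      by blast
    show "\<exists>x. \<forall>i\<in>I. lower_density (return_set T x (V i) \<inter> A i) > 0"
    proof (intro exI ballI)
      fix i assume "i \<in> I"
      then show "lower_density (return_set T l (V i) \<inter> A i) > 0"
        using l[of i] by (simp add: V'_def A'_def)
    qed
  qed
qed

end
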